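(* Let $(X,d)$ be a complete, locally compact, convergence-symmetric length metric space. Suppose that for all sequences $(x_n),(y_n)$ in $X$, if the sequence $(d(x_n,y_n))$ is bounded then the sequence $(d(y_n,x_n))$ is bounded as well. Then $X$ is a geodesic space.
   Context: A metric on a non-empty set $X$ is a function $d:X\times X\to[0,\infty)$ with $d(x,y)=0$ iff $x=y$, and $d(x,z)\le d(x,y)+d(y,z)$ for all $x,y,z$; symmetry is NOT assumed. $(X,d)$ is convergence-symmetric if for any two sequences $(p_n),(q_n)$ in $X$, $d(p_n,q_n)\to0$ if and only if $d(q_n,p_n)\to0$. The topology of such a space is the one induced by the symmetric metric $d_{\mathrm{arith}}(x,y)=\frac12(d(x,y)+d(y,x))$; locally compact and continuous refer to this topology. A sequence $(x_n)$ is Cauchy if for every $\epsilon>0$ there is $N$ with $d(x_i,x_{i+k})<\epsilon$ for all $i\ge N$, $k\ge0$ (in a convergence-symmetric space this is equivalent to the same condition with $d(x_{i+k},x_i)$); the space is complete if every Cauchy sequence converges. A path is a continuous map $c:[a,b]\to X$; its length is $l(c)=\sup\sum_{i=0}^{n-1}d(c(t_i),c(t_{i+1}))$ over all partitions $a=t_0\le t_1\le\dots\le t_n=b$; $c$ is rectifiable if $l(c)<\infty$. $(X,d)$ is a length metric space if for all $x,y\in X$, $d(x,y)$ equals the infimum of the lengths of rectifiable paths from $x$ to $y$. A (constant speed) geodesic from $x$ to $y$ is a map $c:[a,b]\to X$ with $c(a)=x$, $c(b)=y$ for which there is $\beta>0$ such that $d(c(t),c(t'))=\beta(t'-t)$ for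 all $t\le t'$ in $[a,b]$; degenerate intervals $a=b$ are allowed when $x=y$. $(X,d)$ is a geodesic space if for any $x,y\in X$ there is a geodesic from $x$ to $y$. *)

theory Defs
  imports "HOL-Analysis.Analysis"
begin

text \<open>
  Metrics here are not assumed symmetric. They are given by a carrier set \<open>X\<close> and a function
  \<open>d\<close> on the ambient type whose values outside \<open>X\<close> are irrelevant.
\<close>

locale asym_metric =
  fixes X :: "'a set" and d :: "'a \<Rightarrow> 'a \<Rightarrow> real"
  assumes nonempty: "X \<noteq> {}"
    and nonneg: "\<lbrakk>x \<in> X; y \<in> X\<rbrakk> \<Longrightarrow> 0 \<le> d x y"
    and zero: "\<lbrakk>x \<in> X; y \<in> X\<rbrakk> \<Longrightarrow> d x y = 0 \<longleftrightarrow> x = y"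
    and triangle: "\<lbrakk>x \<in> X; y \<in> X; z \<in> X\<rbrakk> \<Longrightarrow> d x z \<le> d x y + d y z"

definition convergence_symmetric :: "'a set \<Rightarrow> ('a \<Rightarrow> 'a \<Rightarrow> real) \<Rightarrow> bool" where
  "convergence_symmetric X d \<longleftrightarrow>
    (\<forall>p q :: nat \<Rightarrow> 'a. range p \<subseteq> X \<longrightarrow> range q \<subseteq> X \<longrightarrow>
      ((\<lambda>n. d (p n) (q n)) \<longlonglongrightarrow> 0) = ((\<lambda>n. d (q n) (p n)) \<longlonglongrightarrow> 0))"

text \<open>
  \<^const>\<open>Metric_space\<close> demands nonnegativity and symmetry on the whole type, so the
  symmetrised metric is set to 0 outside the carrier; its topology only depends on
  the values on \<open>X\<close>.
\<close>

definition d_arith :: "'a set \<Rightarrow> ('a \<Rightarrow> 'a \<Rightarrow> real) \<Rightarrow> 'a \<Rightarrow> 'a \<Rightarrow> real" where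
  "d_arith X d x y = (if x \<in> X \<and> y \<in> X then (d x y + d y x) / 2 else 0)"

lemma (in asym_metric) Metric_space_d_arith: "Metric_space X (d_arith X d)"
proof
  show "0 \<le> d_arith X d x y" for x y
    by (simp add: d_arith_def nonneg)
  show "d_arith X d x y = d_arith X d y x" for x y
    by (simp add: d_arith_def)
  show "d_arith X d x y = 0 \<longleftrightarrow> x = y" if "x \<in> X" "y \<in> X" for x y
    using nonneg[OF that] nonneg[OF that(2,1)] zero[OF that] zero[OF that(2,1)] that
    by (auto simp: d_arith_def add_nonneg_eq_0_iff)
  show "d_arith X d x z \<le> d_arith X d x y + d_arith X d y z"
    if "x \<in> X" "y \<in> X" "z \<in> X" for x y z
    using triangle[of x y z] triangle[of z y x] that
    by (simp add: d_arith_def add_divide_distrib[symmetric])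
qed

definition asym_topology :: "'a set \<Rightarrow> ('a \<Rightarrow> 'a \<Rightarrow> real) \<Rightarrow> 'a topology" where
  "asym_topology X d = Metric_space.mtopology X (d_arith X d)"

definition asym_Cauchy :: "'a set \<Rightarrow> ('a \<Rightarrow> 'a \<Rightarrow> real) \<Rightarrow> (nat \<Rightarrow> 'a) \<Rightarrow> bool" where
  "asym_Cauchy X d x \<longleftrightarrow>
    range x \<subseteq> X \<and> (\<forall>\<epsilon>>0. \<exists>N. \<forall>i\<ge>N. \<forall>k. d (x i) (x (i + k)) < \<epsilon>)"

definition asym_complete :: "'a set \<Rightarrow> ('a \<Rightarrow> 'a \<Rightarrow> real) \<Rightarrow> bool" where
  "asym_complete X d \<longleftrightarrow>
    (\<forall>x. asym_Cauchy X d x \<longrightarrow> (\<exists>l. limitin (asym_topology X d) x l sequentially))"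

definition path_on :: "'a set \<Rightarrow> ('a \<Rightarrow> 'a \<Rightarrow> real) \<Rightarrow> (real \<Rightarrow> 'a) \<Rightarrow> real \<Rightarrow> real \<Rightarrow> bool" where
  "path_on X d c a b \<longleftrightarrow>
    a \<le> b \<and> continuous_map (top_of_set {a..b}) (asym_topology X d) c"

definition partitions :: "real \<Rightarrow> real \<Rightarrow> (nat \<times> (nat \<Rightarrow> real)) set" where
  "partitions a b = {(n, t). t 0 = a \<and> t n = b \<and> (\<forall>i<n. t i \<le> t (Suc i))}"

definition path_len :: "('a \<Rightarrow> 'a \<Rightarrow> real) \<Rightarrow> (real \<Rightarrow> 'a) \<Rightarrow> real \<Rightarrow> real \<Rightarrow> ereal" where
  "path_len d c a b =
    (SUP (n, t) \<in> partitions a b. ereal (\<Sum>i<n. d (c (t i)) (c (t (Suc i)))))"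

definition rectifiable_paths ::
    "'a set \<Rightarrow> ('a \<Rightarrow> 'a \<Rightarrow> real) \<Rightarrow> 'a \<Rightarrow> 'a \<Rightarrow> ((real \<Rightarrow> 'a) \<times> real \<times> real) set" where
  "rectifiable_paths X d x y =
    {(c, a, b). path_on X d c a b \<and> c a = x \<and> c b = y \<and> path_len d c a b < \<infinity>}"

text \<open>
  The infimum is taken in the extended reals, where the empty set has infimum \<open>\<infinity>\<close>;
  hence any two points of a length metric space are joined by a rectifiable path.
\<close>

definition length_metric :: "'a set \<Rightarrow> ('a \<Rightarrow> 'a \<Rightarrow> real) \<Rightarrow> bool" where
  "length_metric X d \<longleftrightarrow>
    (\<forall>x\<in>X. \<forall>y\<in>X.
      ereal (d x y) = (INF (c, a, b) \<in> rectifiable_paths X d x y. path_len d c a b))"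

definition asym_geodesic ::
    "'a set \<Rightarrow> ('a \<Rightarrow> 'a \<Rightarrow> real) \<Rightarrow> (real \<Rightarrow> 'a) \<Rightarrow> real \<Rightarrow> real \<Rightarrow> 'a \<Rightarrow> 'a \<Rightarrow> bool" where
  "asym_geodesic X d c a b x y \<longleftrightarrow>
    a \<le> b \<and> c ` {a..b} \<subseteq> X \<and> c a = x \<and> c b = y \<and>
    (\<exists>\<beta>>0. \<forall>t\<in>{a..b}. \<forall>t'\<in>{a..b}. t \<le> t' \<longrightarrow> d (c t) (c t') = \<beta> * (t' - t))"

definition geodesic_space :: "'a set \<Rightarrow> ('a \<Rightarrow> 'a \<Rightarrow> real) \<Rightarrow> bool" where
  "geodesic_space X d \<longleftrightarrow> (\<forall>x\<in>X. \<forall>y\<in>X. \<exists>c a b. asym_geodesic X d c a b x y)"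

end

theory Submission
  imports Defs
begin

text \<open>
  The proof is the Hopf--Rinow argument, carried out with forward closed balls
  \<open>{y \<in> X. d x y \<le> r}\<close>.

  Convergence symmetry replaces symmetry. By a contradiction with sequences it is a uniform
  statement: a pair with small \<open>d x y\<close> is close in the symmetrised metric, with bounds that do
  not depend on the pair. Since \<open>d\<close> is at most twice the symmetrised metric, a Cauchy sequence
  for the latter is Cauchy for \<open>d\<close>, so the symmetrised metric is complete. By the
  intermediate value theorem along almost shortest paths, a length metric has approximate
  intermediate points: for \<open>0 \<le> s \<le> d x y\<close> there is \<open>z\<close> with \<open>d x z = s\<close> and \<open>d z y\<close>
  exceeding \<open>d x y - s\<close> by as little as desired.

  Fix a centre. If the forward balls of radius below \<open>R\<close> are compact, approximate intermediate
  points put the ball of radius \<open>R\<close> within arbitrarily small distance of compact ones, so it is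
  totally bounded and, by completeness, compact. If the ball of radius \<open>R\<close> is compact,
  it has a compact neighbourhood by local compactness, and this neighbourhood contains the ball
  of some larger radius. So the radii of compact forward balls have no finite supremum.

  Compactness turns approximate intermediate points into exact ones. A geodesic from \<open>x\<close> to
  \<open>y\<close> is then a maximal isometric partial map from the interval \<open>[0, d x y]\<close> to \<open>X\<close>: a time
  missing from its domain could be filled in, since the finite intersection property reduces
  compatibility with all values already chosen to compatibility with the two nearest among
  finitely many, which an exact intermediate point provides.
\<close>

section \<open>The symmetrised metric\<close>

context asym_metric
begin

sublocale sym: Metric_space X "d_arith X d"
  by (rule Metric_space_d_arith)

lemma asym_topology_eq: "asym_topology X d = sym.mtopology"
  by (simp add: asym_topology_def)

lemma dist_le_d_arith:
  assumes "x \<in> X" "y \<in> X"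
  shows "d x y \<le> 2 * d_arith X d x y" "d y x \<le> 2 * d_arith X d x y"
  using assms nonneg[of x y] nonneg[of y x] by (simp_all add: d_arith_def)

lemma continuous_map_d_arith_lipschitz:
  fixes f :: "'a \<Rightarrow> real"
  assumes "\<And>y z. y \<in> X \<Longrightarrow> z \<in> X \<Longrightarrow> f z \<le> f y + 2 * d_arith X d y z"
  shows "continuous_map sym.mtopology euclideanreal f"
  unfolding sym.continuous_map_from_metric
proof (intro conjI ballI allI impI)
  show "f \<in> X \<rightarrow> topspace euclideanreal" by simp
  fix a U assume a: "a \<in> X" and U: "openin euclideanreal U \<and> f a \<in> U"
  then obtain e where e: "e > 0" "\<And>u. dist u (f a) < e \<Longrightarrow> u \<in> U"
    by (auto simp: open_dist)
  have "f z \<in> U" if z: "z \<in> X" "d_arith X d a z < e / 2" for z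
  proof (rule e(2))
    show "dist (f z) (f a) < e"
      using assms[OF a z(1)] assms[OF z(1) a] z(2) sym.commute[of a z]
      by (simp add: dist_real_def abs_less_iff)
  qed
  then show "\<exists>r>0. \<forall>z. z \<in> X \<and> d_arith X d a z < r \<longrightarrow> f z \<in> U"
    using e(1) by (intro exI[of _ "e / 2"]) auto
qed

lemma continuous_map_dist_from:
  assumes "x \<in> X"
  shows "continuous_map sym.mtopology euclideanreal (\<lambda>y. d x y)"
proof (rule continuous_map_d_arith_lipschitz)
  fix y z assume "y \<in> X" "z \<in> X"
  then show "d x z \<le> d x y + 2 * d_arith X d y z"
    using triangle[OF assms, of y z] dist_le_d_arith(1)[of y z] by linarith
qed

lemma continuous_map_dist_to:
  assumes "x \<in> X"
  shows "continuous_map sym.mtopology euclideanreal (\<lambda>y. d y x)"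
proof (rule continuous_map_d_arith_lipschitz)
  fix y z assume "y \<in> X" "z \<in> X"
  then show "d z x \<le> d y x + 2 * d_arith X d y z"
    using triangle[of z y x] assms dist_le_d_arith(2)[of y z] by linarith
qed

definition fwd_cball :: "'a \<Rightarrow> real \<Rightarrow> 'a set" where
  "fwd_cball x r = {y \<in> X. d x y \<le> r}"

lemma closedin_fwd_cball:
  assumes "x \<in> X"
  shows "closedin sym.mtopology (fwd_cball x r)"
proof -
  have "closedin euclideanreal {..r}" by simp
  from closedin_continuous_map_preimage[OF continuous_map_dist_from[OF assms] this]
  show ?thesis by (simp add: fwd_cball_def)
qed

lemma closedin_bwd_cball:
  assumes "x \<in> X"
  shows "closedin sym.mtopology {y \<in> X. d y x \<le> r}"
proof -
  have "closedin euclideanreal {..r}" by simp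
  from closedin_continuous_map_preimage[OF continuous_map_dist_to[OF assms] this]
  show ?thesis by simp
qed

text \<open>
  A failure of uniformity at \<open>\<epsilon>\<close> yields sequences \<open>p\<close>, \<open>q\<close> with \<open>d (p n) (q n)\<close> tending to 0
  while the symmetrised distances stay above \<open>\<epsilon>\<close>.
\<close>

lemma convergence_symmetric_uniform:
  assumes "convergence_symmetric X d" "\<epsilon> > 0"
  obtains \<delta> where "\<delta> > 0"
    "\<And>x y. x \<in> X \<Longrightarrow> y \<in> X \<Longrightarrow> d x y < \<delta> \<Longrightarrow> d_arith X d x y < \<epsilon>"
proof -
  have "\<exists>\<delta>>0. \<forall>x\<in>X. \<forall>y\<in>X. d x y < \<delta> \<longrightarrow> d_arith X d x y < \<epsilon>"
  proof (rule ccontr)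
    assume "\<not> ?thesis"
    then have "\<forall>n::nat. \<exists>x y. x \<in> X \<and> y \<in> X \<and> d x y < inverse (Suc n) \<and> \<epsilon> \<le> d_arith X d x y"
      by (metis inverse_positive_iff_positive not_less of_nat_0_less_iff zero_less_Suc)
    then obtain p q where pq: "\<And>n. p n \<in> X" "\<And>n. q n \<in> X"
      "\<And>n. d (p n) (q n) < inverse (real (Suc n))" "\<And>n. \<epsilon> \<le> d_arith X d (p n) (q n)"
      by metis
    have lim: "(\<lambda>n. d (p n) (q n)) \<longlonglongrightarrow> 0"
      by (rule tendsto_sandwich[OF _ _ tendsto_const LIMSEQ_inverse_real_of_nat])
        (auto intro!: always_eventually nonneg pq(1,2) less_imp_le[OF pq(3), simplified])
    have "(\<lambda>n. d (q n) (p n)) \<longlonglongrightarrow> 0"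
      using assms(1) lim pq(1,2) unfolding convergence_symmetric_def
      by (metis image_subsetI)
    then have "(\<lambda>n. (d (p n) (q n) + d (q n) (p n)) / 2) \<longlonglongrightarrow> 0"
      using tendsto_divide[OF tendsto_add[OF lim], of "\<lambda>n. d (q n) (p n)" 0 "\<lambda>_. 2" 2] by simp
    then have "\<epsilon> \<le> 0"
      by (rule LIMSEQ_le_const) (use pq in \<open>auto simp: d_arith_def\<close>)
    then show False using assms(2) by simp
  qed
  then show thesis using that by blast
qed

lemma mcomplete_d_arith:
  assumes "asym_complete X d"
  shows "sym.mcomplete"
  unfolding sym.mcomplete_def
proof (intro allI impI)
  fix \<sigma> assume \<sigma>: "sym.MCauchy \<sigma>"
  have ran: "range \<sigma> \<subseteq> X" using \<sigma> by (simp add: sym.MCauchy_def)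
  have "asym_Cauchy X d \<sigma>"
    unfolding asym_Cauchy_def
  proof (intro conjI allI impI ran)
    fix e :: real assume "e > 0"
    then obtain N where N: "\<And>n m. N \<le> n \<Longrightarrow> N \<le> m \<Longrightarrow> d_arith X d (\<sigma> n) (\<sigma> m) < e / 2"
      using \<sigma> unfolding sym.MCauchy_def by (meson half_gt_zero)
    have "d (\<sigma> i) (\<sigma> (i + k)) < e" if "i \<ge> N" for i k
      using dist_le_d_arith(1)[of "\<sigma> i" "\<sigma> (i + k)"] N[of i "i + k"] that ran
      by (simp add: image_subset_iff)
    then show "\<exists>N. \<forall>i\<ge>N. \<forall>k. d (\<sigma> i) (\<sigma> (i + k)) < e" by blast
  qed
  then show "\<exists>x. limitin sym.mtopology \<sigma> x sequentially"
    using assms by (simp add: asym_complete_def asym_topology_eq)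
qed

section \<open>Approximate intermediate points\<close>

lemma path_len_ge_via_point:
  assumes "a \<le> u" "u \<le> b"
  shows "ereal (d (c a) (c u) + d (c u) (c b)) \<le> path_len d c a b"
proof -
  define t :: "nat \<Rightarrow> real" where "t = (\<lambda>i. if i = 0 then a else if i = 1 then u else b)"
  have "(2, t) \<in> partitions a b"
    using assms by (auto simp: partitions_def t_def)
  moreover have "(\<Sum>i<2. d (c (t i)) (c (t (Suc i)))) = d (c a) (c u) + d (c u) (c b)"
    by (simp add: t_def numeral_2_eq_2)
  ultimately show ?thesis
    unfolding path_len_def by (intro SUP_upper2[of "(2, t)"]) auto
qed

text \<open>
  Along a path from \<open>x\<close> to \<open>y\<close> of length below \<open>d x y + \<eta>\<close>, the continuous function
  \<open>d x\<close> runs from 0 to \<open>d x y\<close> and so takes the value \<open>s\<close>.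
\<close>

lemma length_metric_approx_intermediate:
  assumes "length_metric X d" "x \<in> X" "y \<in> X" "0 \<le> s" "s \<le> d x y" "\<eta> > 0"
  obtains z where "z \<in> X" "d x z = s" "d z y < d x y - s + \<eta>"
proof -
  have "(INF (c, a, b) \<in> rectifiable_paths X d x y. path_len d c a b) < ereal (d x y + \<eta>)"
    using assms unfolding length_metric_def by (metis less_add_same_cancel1 less_ereal.simps(1))
  then obtain c a b where cab: "(c, a, b) \<in> rectifiable_paths X d x y"
    and len: "path_len d c a b < ereal (d x y + \<eta>)"
    by (auto simp: INF_less_iff)
  have ab: "a \<le> b" and cont: "continuous_map (top_of_set {a..b}) sym.mtopology c"
    and ends: "c a = x" "c b = y"
    using cab by (auto simp: rectifiable_paths_def path_on_def asym_topology_eq)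
  have "continuous_on {a..b} (\<lambda>t. d x (c t))"
    using continuous_map_compose[OF cont continuous_map_dist_from[OF assms(2)]]
    by (simp add: o_def)
  moreover have "d x (c a) \<le> s" "s \<le> d x (c b)"
    using assms zero[of x x] by (auto simp: ends)
  ultimately obtain t where t: "a \<le> t" "t \<le> b" "d x (c t) = s"
    using IVT'[of "\<lambda>t. d x (c t)" a s b] ab by blast
  have "c t \<in> X"
    using continuous_map_image_subset_topspace[OF cont] t by auto
  moreover have "d x (c t) + d (c t) y < d x y + \<eta>"
    using path_len_ge_via_point[OF t(1,2), of c] len ends
    by (metis ereal_less_le le_less_trans less_ereal.simps(1))
  ultimately show thesis using that t(3) by auto
qed

section \<open>Compactness of forward balls\<close>

text \<open>
  Given \<open>\<epsilon>\<close>, every point of the ball of radius \<open>R\<close> is \<open>\<epsilon>\<close>-close to an approximate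
  intermediate point in a slightly smaller, compact ball; a finite net of the latter serves
  for the former.
\<close>

lemma compactin_fwd_cball_limit:
  assumes "sym.mcomplete" "convergence_symmetric X d" "length_metric X d" "x \<in> X"
    and smaller: "\<And>r. 0 \<le> r \<Longrightarrow> r < R \<Longrightarrow> compactin sym.mtopology (fwd_cball x r)"
  shows "compactin sym.mtopology (fwd_cball x R)"
proof (cases "R > 0")
  case False
  have "fwd_cball x R \<subseteq> {x}"
    using False nonneg zero \<open>x \<in> X\<close> by (fastforce simp: fwd_cball_def)
  then show ?thesis
    using \<open>x \<in> X\<close> by (intro finite_imp_compactin) (auto simp: fwd_cball_def intro: finite_subset)
next
  case True
  have "sym.mtotally_bounded (fwd_cball x R)"
    unfolding sym.mtotally_bounded_def
  proof (intro allI impI)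
    fix \<epsilon> :: real assume "\<epsilon> > 0"
    then obtain \<delta> where "\<delta> > 0"
      and \<delta>: "\<And>u v. u \<in> X \<Longrightarrow> v \<in> X \<Longrightarrow> d u v < \<delta> \<Longrightarrow> d_arith X d u v < \<epsilon> / 2"
      using convergence_symmetric_uniform[OF assms(2), of "\<epsilon> / 2"] by auto
    define r where "r = max 0 (R - \<delta> / 2)"
    have r: "0 \<le> r" "r < R" "R - r \<le> \<delta> / 2"
      using True \<open>\<delta> > 0\<close> unfolding r_def by linarith+
    obtain F where F: "finite F" "F \<subseteq> fwd_cball x r"
      and cover: "fwd_cball x r \<subseteq> (\<Union>f\<in>F. sym.mball f (\<epsilon> / 2))"
      using sym.compactin_imp_mtotally_bounded[OF smaller[OF r(1,2)]] \<open>\<epsilon> > 0\<close>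
      unfolding sym.mtotally_bounded_def by (meson half_gt_zero)
    have net: "\<exists>f\<in>F. y \<in> sym.mball f \<epsilon>" if y: "y \<in> fwd_cball x R" for y
    proof -
      have yX: "y \<in> X" and yR: "d x y \<le> R" using y by (auto simp: fwd_cball_def)
      obtain z where z: "z \<in> fwd_cball x r" and zy: "d_arith X d z y < \<epsilon> / 2"
      proof (cases "d x y \<le> r")
        case True
        then show thesis using that[of y] yX \<open>\<epsilon> > 0\<close> by (simp add: fwd_cball_def)
      next
        case False
        then obtain z where "z \<in> X" "d x z = r" "d z y < d x y - r + \<delta> / 2"
          using length_metric_approx_intermediate[OF assms(3,4) yX r(1), of "\<delta> / 2"] \<open>\<delta> > 0\<close>
          by auto
        then show thesis
          using that[of z] \<delta>[of z y] yX yR r by (simp add: fwd_cball_def)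
      qed
      obtain f where f: "f \<in> F" "z \<in> sym.mball f (\<epsilon> / 2)"
        using z cover by blast
      then have "d_arith X d f y < \<epsilon>"
        using sym.triangle[of f z y] zy yX by auto
      then show ?thesis using f yX by auto
    qed
    have "F \<subseteq> fwd_cball x R" using F(2) r by (auto simp: fwd_cball_def)
    moreover have "fwd_cball x R \<subseteq> (\<Union>f\<in>F. sym.mball f \<epsilon>)"
      by (intro subsetI UN_iff[THEN iffD2] net)
    ultimately show "\<exists>K. finite K \<and> K \<subseteq> fwd_cball x R \<and> fwd_cball x R \<subseteq> (\<Union>f\<in>K. sym.mball f \<epsilon>)"
      using F(1) by (intro exI[of _ F] conjI)
  qed
  then have "compactin sym.mtopology (sym.mtopology closure_of fwd_cball x R)"
    using sym.mtotally_bounded_eq_compact_closure_of assms(1) by blast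
  then show ?thesis
    using closedin_fwd_cball[OF \<open>x \<in> X\<close>] by (simp add: closure_of_closedin)
qed

text \<open>
  The margin by which a compact neighbourhood surrounds the compact ball is a Lebesgue number.
  A point at forward distance below \<open>\<delta>\<close> from the ball is, by uniformity, within that margin.
\<close>

lemma compactin_fwd_cball_extend:
  assumes "locally_compact_space sym.mtopology" "convergence_symmetric X d"
    "length_metric X d" "x \<in> X" "0 \<le> R"
    and compact: "compactin sym.mtopology (fwd_cball x R)"
  obtains R' where "R' > R" "compactin sym.mtopology (fwd_cball x R')"
proof -
  obtain U L where U: "openin sym.mtopology U" and L: "compactin sym.mtopology L"
    and sub: "fwd_cball x R \<subseteq> U" "U \<subseteq> L"
    using assms(1) compact
    by (metis locally_compact_space_compact_closed_compact sym.Hausdorff_space_mtopology)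
  obtain \<epsilon> where "\<epsilon> > 0" and \<epsilon>: "\<And>z. z \<in> fwd_cball x R \<Longrightarrow> sym.mball z \<epsilon> \<subseteq> U"
    using sym.lebesgue_number[OF compact, of "{U}"] U sub(1) by auto
  obtain \<delta> where "\<delta> > 0"
    and \<delta>: "\<And>u v. u \<in> X \<Longrightarrow> v \<in> X \<Longrightarrow> d u v < \<delta> \<Longrightarrow> d_arith X d u v < \<epsilon>"
    using convergence_symmetric_uniform[OF assms(2) \<open>\<epsilon> > 0\<close>] by blast
  have "fwd_cball x (R + \<delta> / 2) \<subseteq> U"
  proof
    fix y assume "y \<in> fwd_cball x (R + \<delta> / 2)"
    then have yX: "y \<in> X" and yR: "d x y \<le> R + \<delta> / 2" by (auto simp: fwd_cball_def)
    show "y \<in> U"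
    proof (cases "d x y \<le> R")
      case True
      then show ?thesis using sub(1) yX by (auto simp: fwd_cball_def)
    next
      case False
      then obtain z where z: "z \<in> X" "d x z = R" "d z y < d x y - R + \<delta> / 2"
        using length_metric_approx_intermediate[OF assms(3,4) yX assms(5), of "\<delta> / 2"] \<open>\<delta> > 0\<close>
        by auto
      then have "y \<in> sym.mball z \<epsilon>" using \<delta>[of z y] yX yR by simp
      then show ?thesis using \<epsilon>[of z] z by (auto simp: fwd_cball_def)
    qed
  qed
  then have "compactin sym.mtopology (fwd_cball x (R + \<delta> / 2))"
    using closed_compactin[OF L] closedin_fwd_cball[OF assms(4)] sub(2) by blast
  then show thesis using that \<open>\<delta> > 0\<close> by (metis half_gt_zero less_add_same_cancel1)
qed

lemma compactin_fwd_cball: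
  assumes "sym.mcomplete" "locally_compact_space sym.mtopology" "convergence_symmetric X d"
    "length_metric X d" "x \<in> X"
  shows "compactin sym.mtopology (fwd_cball x r)"
proof (rule ccontr)
  let ?P = "\<lambda>r. compactin sym.mtopology (fwd_cball x r)"
  assume not: "\<not> ?P r"
  have down: "?P s" if "?P t" "s \<le> t" for s t
    using closed_compactin[OF that(1)] closedin_fwd_cball[OF assms(5), of s] that(2)
    by (simp add: fwd_cball_def Collect_mono_iff subset_iff)
  define S where "S = {s. 0 \<le> s \<and> ?P s}"
  have "?P 0" using compactin_fwd_cball_limit[OF assms(1,3,4,5), of 0] by force
  then have "0 \<in> S" by (simp add: S_def)
  have bdd: "bdd_above S"
  proof (rule bdd_aboveI)
    show "s \<le> r" if "s \<in> S" for s
      using down[of s r] not that by (cases "s \<le> r") (simp_all add: S_def)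
  qed
  have "0 \<le> Sup S" by (rule cSup_upper[OF \<open>0 \<in> S\<close> bdd])
  have "?P s" if "s < Sup S" for s
  proof -
    obtain t where "t \<in> S" "s < t" 
      using less_cSupD[of S s] \<open>0 \<in> S\<close> \<open>s < Sup S\<close> by (metis empty_iff)
    then show ?thesis using down[of t s] by (simp add: S_def)
  qed
  then have "?P (Sup S)"
    using compactin_fwd_cball_limit[OF assms(1,3,4,5)] by blast
  then obtain R where "R > Sup S" "?P R"
    using compactin_fwd_cball_extend[OF assms(2-5) \<open>0 \<le> Sup S\<close>] by blast
  then have "R \<in> S" using \<open>0 \<le> Sup S\<close> by (simp add: S_def)
  then show False using cSup_upper[OF _ bdd] \<open>R > Sup S\<close> by force
qed

section \<open>Geodesics\<close>

text \<open>
  The function \<open>z \<mapsto> d z y\<close> attains its minimum on the compact ball of radius \<open>s\<close> about \<open>x\<close>;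
  approximate intermediate points bound the minimum by \<open>d x y - s\<close>.
\<close>

lemma exact_intermediate:
  assumes "\<And>x r. x \<in> X \<Longrightarrow> compactin sym.mtopology (fwd_cball x r)"
    and "length_metric X d" "x \<in> X" "y \<in> X" "0 \<le> s" "s \<le> d x y"
  obtains z where "z \<in> X" "d x z = s" "d z y = d x y - s"
proof -
  let ?I = "(\<lambda>z. d z y) ` fwd_cball x s"
  have "compact ?I"
    using image_compactin[OF assms(1)[OF assms(3)] continuous_map_dist_to[OF assms(4)]] by simp
  moreover have "x \<in> fwd_cball x s"
    using assms(3,5) zero[of x x] by (simp add: fwd_cball_def)
  ultimately obtain z where z: "z \<in> fwd_cball x s"
    and least: "\<And>w. w \<in> fwd_cball x s \<Longrightarrow> d z y \<le> d w y"
    using compact_attains_inf[of ?I] by blast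
  have "d z y \<le> d x y - s"
  proof (rule field_le_epsilon)
    fix e :: real assume "e > 0"
    then obtain w where "w \<in> X" "d x w = s" "d w y < d x y - s + e"
      using length_metric_approx_intermediate[OF assms(2-6)] by blast
    then show "d z y \<le> d x y - s + e" using least[of w] by (simp add: fwd_cball_def)
  qed
  moreover have "z \<in> X" "d x z \<le> s" using z by (auto simp: fwd_cball_def)
  ultimately show thesis using that triangle[of x z y] assms(3,4) by force
qed

text \<open>
  Partial geodesics are encoded by their graphs, so that Zorn's lemma applies to inclusion.
  Single-valuedness need not be demanded: two values at the same time have distance 0.
\<close>

definition partial_geodesics :: "'a \<Rightarrow> 'a \<Rightarrow> (real \<times> 'a) set set" where
  "partial_geodesics x y = {G. G \<subseteq> {0..d x y} \<times> X \<and> (0, x) \<in> G \<and> (d x y, y) \<in> G \<and>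
     (\<forall>s p t q. (s, p) \<in> G \<longrightarrow> (t, q) \<in> G \<longrightarrow> s \<le> t \<longrightarrow> d p q = t - s)}"

text \<open>
  It suffices to bound the distances between the new point and the values already chosen from
  above, because the lower bounds then follow from the triangle inequality and the two endpoints.
  These upper bounds define closed subsets of the compact ball of radius \<open>d x y\<close> about \<open>x\<close>.
  For finitely many of them, an exact intermediate point between the nearest earlier and the
  nearest later value satisfies all.
\<close>

lemma partial_geodesic_extend:
  assumes compact: "\<And>x r. x \<in> X \<Longrightarrow> compactin sym.mtopology (fwd_cball x r)"
    and len: "length_metric X d" and xy: "x \<in> X" "y \<in> X"
    and G: "G \<in> partial_geodesics x y" and t: "0 \<le> t" "t \<le> d x y"
  obtains p where "p \<in> X" "insert (t, p) G \<in> partial_geodesics x y"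
proof -
  have sub: "G \<subseteq> {0..d x y} \<times> X"
    and ends: "(0, x) \<in> G" "(d x y, y) \<in> G"
    and iso: "\<And>s p u q. (s, p) \<in> G \<Longrightarrow> (u, q) \<in> G \<Longrightarrow> s \<le> u \<Longrightarrow> d p q = u - s"
    using G unfolding partial_geodesics_def by blast+
  have GX: "\<And>s q. (s, q) \<in> G \<Longrightarrow> 0 \<le> s \<and> s \<le> d x y \<and> q \<in> X"
    using sub by auto
  define C where "C = (\<lambda>(s, q). {p \<in> X. (s \<le> t \<longrightarrow> d q p \<le> t - s) \<and> (t \<le> s \<longrightarrow> d p q \<le> s - t)})"
  have closed: "closedin sym.mtopology (C g)" if "g \<in> G" for g
  proof -
    obtain s q where g: "g = (s, q)" by force
    then have q: "q \<in> X" using GX that by blast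
    have "C g = (if s \<le> t then fwd_cball q (t - s) else X) \<inter>
                (if t \<le> s then {p \<in> X. d p q \<le> s - t} else X)"
      by (auto simp: C_def g fwd_cball_def)
    then show ?thesis
      using closedin_fwd_cball[OF q] closedin_bwd_cball[OF q]
      by (auto intro!: closedin_Int)
  qed
  have finite_case: "fwd_cball x (d x y) \<inter> \<Inter>(C ` F) \<noteq> {}" if F: "finite F" "F \<subseteq> G" for F
  proof -
    define E where "E = insert (0, x) (insert (d x y, y) F)"
    have E: "finite E" "E \<subseteq> G" using F ends by (auto simp: E_def)
    define A where "A = {g \<in> E. fst g \<le> t}"
    define B where "B = {g \<in> E. t \<le> fst g}"
    have fin: "finite A" "finite B" and ne: "A \<noteq> {}" "B \<noteq> {}"
      using E(1) t by (auto simp: A_def B_def E_def)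
    obtain a u where au: "(a, u) \<in> A" and a_max: "\<And>s q. (s, q) \<in> A \<Longrightarrow> s \<le> a"
    proof -
      have "Max (fst ` A) \<in> fst ` A" using fin ne by simp
      then obtain a u where "(a, u) \<in> A" "a = Max (fst ` A)" by force
      then show thesis using that fin(1) by (metis Max_ge finite_imageI fst_conv image_eqI)
    qed
    obtain b v where bv: "(b, v) \<in> B" and b_min: "\<And>s q. (s, q) \<in> B \<Longrightarrow> b \<le> s"
    proof -
      have "Min (fst ` B) \<in> fst ` B" using fin ne by simp
      then obtain b v where "(b, v) \<in> B" "b = Min (fst ` B)" by force
      then show thesis using that fin(2) by (metis Min_le finite_imageI fst_conv image_eqI)
    qed
    have AB: "A \<subseteq> G" "B \<subseteq> G" using E by (auto simp: A_def B_def)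
    have auG: "(a, u) \<in> G" "a \<le> t" and bvG: "(b, v) \<in> G" "t \<le> b"
      using au bv AB by (auto simp: A_def B_def)
    have uv: "u \<in> X" "v \<in> X" using GX auG bvG by blast+
    have duv: "d u v = b - a" using iso auG bvG by auto
    obtain p where p: "p \<in> X" "d u p = t - a" "d p v = b - t"
      using exact_intermediate[OF compact len uv, of "t - a"] duv auG bvG by auto
    have "p \<in> C g" if "g \<in> E" for g
    proof -
      obtain s q where g: "g = (s, q)" by force
      have sq: "(s, q) \<in> G" using that g E by auto
      then have q: "q \<in> X" using GX by blast
      have "d q p \<le> t - s" if "s \<le> t"
      proof -
        have "s \<le> a" using that \<open>g \<in> E\<close> g a_max by (auto simp: A_def)
        then show ?thesis using iso[OF sq auG(1)] triangle[OF q uv(1) p(1)] p by linarith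
      qed
      moreover have "d p q \<le> s - t" if "t \<le> s"
      proof -
        have "b \<le> s" using that \<open>g \<in> E\<close> g b_min by (auto simp: B_def)
        then show ?thesis using iso[OF bvG(1) sq] triangle[OF p(1) uv(2) q] p by linarith
      qed
      ultimately show ?thesis using p by (simp add: C_def g)
    qed
    moreover from this[of "(0, x)"] p have "p \<in> fwd_cball x (d x y)"
      using t by (auto simp: C_def fwd_cball_def E_def)
    ultimately show ?thesis by (auto simp: E_def)
  qed
  have "fwd_cball x (d x y) \<inter> \<Inter>\<F> \<noteq> {}" if \<F>: "finite \<F>" "\<F> \<subseteq> C ` G" for \<F>
  proof -
    obtain F where "F \<subseteq> G" "finite F" "\<F> = C ` F"
      using finite_subset_image[OF \<F>] by blast
    then show ?thesis using finite_case by simp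
  qed
  moreover have "\<forall>K\<in>C ` G. closedin sym.mtopology K" using closed by simp
  ultimately have "fwd_cball x (d x y) \<inter> \<Inter>(C ` G) \<noteq> {}"
    using compact[OF xy(1), of "d x y"] unfolding compactin_fip by simp
  then obtain p where pC: "\<And>g. g \<in> G \<Longrightarrow> p \<in> C g" by blast
  have p: "p \<in> X" using pC[OF ends(1)] by (simp add: C_def)
  have xp: "d x p \<le> t" and py: "d p y \<le> d x y - t"
    using pC[OF ends(1)] pC[OF ends(2)] t by (simp_all add: C_def)
  have before: "d q p = t - s" if "(s, q) \<in> G" "s \<le> t" for s q
    using pC[OF that(1)] that GX[OF that(1)] iso[OF that(1) ends(2)] triangle[of q p y] p xy py
    by (simp add: C_def)
  have after: "d p q = s - t" if "(s, q) \<in> G" "t \<le> s" for s q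
    using pC[OF that(1)] that GX[OF that(1)] iso[OF ends(1) that(1)] triangle[of x p q] p xy xp
    by (simp add: C_def)
  have "insert (t, p) G \<in> partial_geodesics x y"
    using G t p before after zero[OF p p] unfolding partial_geodesics_def by auto
  then show thesis using that p by blast
qed

lemma geodesic_exists:
  assumes compact: "\<And>x r. x \<in> X \<Longrightarrow> compactin sym.mtopology (fwd_cball x r)"
    and len: "length_metric X d" and xy: "x \<in> X" "y \<in> X"
  obtains c where "asym_geodesic X d c 0 (d x y) x y"
proof -
  have "{(0, x), (d x y, y)} \<in> partial_geodesics x y"
  proof (cases "x = y")
    case True
    then have "d x y = 0" "d y y = 0" using zero xy by auto
    then show ?thesis using True xy by (simp add: partial_geodesics_def)
  next
    case False
    then have "d x y > 0" using nonneg[OF xy] zero[OF xy] by simp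
    moreover have "d x x = 0" "d y y = 0" using zero xy by simp_all
    ultimately show ?thesis using xy by (auto simp: partial_geodesics_def)
  qed
  then have "partial_geodesics x y \<noteq> {}" by blast
  moreover have "\<Union>\<C> \<in> partial_geodesics x y"
    if "\<C> \<noteq> {}" "subset.chain (partial_geodesics x y) \<C>" for \<C>
  proof -
    have \<C>: "\<C> \<subseteq> partial_geodesics x y" using that(2) by (simp add: subset.chain_def)
    have "d p q = u - s" if sp: "(s, p) \<in> \<Union>\<C>" "(u, q) \<in> \<Union>\<C>" "s \<le> u" for s p u q
    proof -
      obtain H where "H \<in> \<C>" "(s, p) \<in> H" "(u, q) \<in> H"
        using sp \<open>subset.chain (partial_geodesics x y) \<C>\<close>
        by (meson UnionE subsetD subset_chain_def)
      then show ?thesis using \<C> sp(3) by (auto simp: partial_geodesics_def subset_iff)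
    qed
    moreover have "H \<subseteq> {0..d x y} \<times> X" "(0, x) \<in> H" "(d x y, y) \<in> H" if "H \<in> \<C>" for H
      using \<C> that unfolding partial_geodesics_def by blast+
    then have "\<Union>\<C> \<subseteq> {0..d x y} \<times> X" "(0, x) \<in> \<Union>\<C>" "(d x y, y) \<in> \<Union>\<C>"
      using \<open>\<C> \<noteq> {}\<close> by blast+
    ultimately show ?thesis unfolding partial_geodesics_def by blast
  qed
  ultimately obtain G where G: "G \<in> partial_geodesics x y"
    and maximal: "\<And>H. H \<in> partial_geodesics x y \<Longrightarrow> G \<subseteq> H \<Longrightarrow> H = G"
    using subset_Zorn_nonempty[of "partial_geodesics x y"] by blast
  have GX: "\<And>s q. (s, q) \<in> G \<Longrightarrow> q \<in> X"
    and ends: "(0, x) \<in> G" "(d x y, y) \<in> G"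
    and iso: "\<And>s p u q. (s, p) \<in> G \<Longrightarrow> (u, q) \<in> G \<Longrightarrow> s \<le> u \<Longrightarrow> d p q = u - s"
    using G unfolding partial_geodesics_def by blast+
  have "\<exists>p. (t, p) \<in> G" if "0 \<le> t" "t \<le> d x y" for t
    using partial_geodesic_extend[OF compact len xy G that] maximal
    by (metis insertI1 subset_insertI)
  then obtain c where c: "\<And>t. 0 \<le> t \<Longrightarrow> t \<le> d x y \<Longrightarrow> (t, c t) \<in> G"
    by metis
  have unique: "p = q" if "(t, p) \<in> G" "(t, q) \<in> G" for t p q
    using iso[OF that] zero[of p q] GX that by force
  have "asym_geodesic X d c 0 (d x y) x y"
    unfolding asym_geodesic_def
  proof (intro conjI exI[of _ "1::real"] ballI impI)
    show "0 \<le> d x y" using nonneg[OF xy] .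
    then show "c 0 = x" "c (d x y) = y"
      using unique[OF c ends(1)] unique[OF c ends(2)] by simp_all
    show "c ` {0..d x y} \<subseteq> X" using GX[OF c] by (simp add: image_subset_iff)
  qed (simp_all add: iso[OF c c])
  then show thesis using that by blast
qed

end

theorem theorem7p20:
  fixes X :: "'a set" and d :: "'a \<Rightarrow> 'a \<Rightarrow> real"
  assumes "asym_metric X d"
    and "asym_complete X d"
    and "locally_compact_space (asym_topology X d)"
    and "convergence_symmetric X d"
    and "length_metric X d"
    and "\<And>x y :: nat \<Rightarrow> 'a. range x \<subseteq> X \<Longrightarrow> range y \<subseteq> X \<Longrightarrow>
           bounded (range (\<lambda>n. d (x n) (y n))) \<Longrightarrow> bounded (range (\<lambda>n. d (y n) (x n)))"
  shows "geodesic_space X d"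
proof -
  interpret asym_metric X d by fact
  have "compactin sym.mtopology (fwd_cball x r)" if "x \<in> X" for x r
    using compactin_fwd_cball[OF mcomplete_d_arith] assms(2-5) that
    by (simp add: asym_topology_eq)
  then show ?thesis
    unfolding geodesic_space_def using geodesic_exists assms(5) by metis
qed

end
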